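(* Let $P\in\mathbb{Z}[x]$ be a monic polynomial of degree $d$ with roots $\alpha_1,\dots,\alpha_d$. For every integer $n>1$, $\Psi_n(P)$ is the square of an integer.
   Context: $\Phi_n$ denotes the $n$-th cyclotomic polynomial and $\phi$ Euler's totient function. Define $\Psi_n(P):=\prod_{1\le j<k\le d}\Big(\alpha_k^{\phi(n)}\Phi_n\big(\tfrac{\alpha_j}{\alpha_k}\big)\Big)^2$, where $\alpha_k^{\phi(n)}\Phi_n(\alpha_j/\alpha_k)$ means the homogeneous expression $\prod_{\zeta}(\alpha_j-\zeta\alpha_k)$, the product over primitive $n$-th roots of unity $\zeta$. *)

theory Defs
  imports "HOL-Analysis.Analysis" "HOL-Computational_Algebra.Computational_Algebra"
    "HOL-Number_Theory.Totient"
begin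

definition primitive_unity_roots :: "nat \<Rightarrow> complex set" where
  "primitive_unity_roots n = {\<zeta>. 0 < n \<and> \<zeta> ^ n = 1 \<and> (\<forall>m. 0 < m \<and> m < n \<longrightarrow> \<zeta> ^ m \<noteq> 1)}"

definition cyclotomic :: "nat \<Rightarrow> complex poly" where
  "cyclotomic n = (\<Prod>\<zeta>\<in>primitive_unity_roots n. [:-\<zeta>, 1:])"

text \<open>
  The homogeneous expression \<open>y ^ totient n * poly (cyclotomic n) (x / y)\<close>, written as a product so
  that it also has its intended value at \<open>y = 0\<close>; see \<open>cyclotomic_hom_eq\<close> below for \<open>y \<noteq> 0\<close>.
\<close>
definition cyclotomic_hom :: "nat \<Rightarrow> complex \<Rightarrow> complex \<Rightarrow> complex" where
  "cyclotomic_hom n x y = (\<Prod>\<zeta>\<in>primitive_unity_roots n. (x - \<zeta> * y))"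

text \<open>
  \<open>Psi n d \<alpha>\<close> is \<open>\<Psi>\<^sub>n(P)\<close> for the monic polynomial \<open>P\<close> with roots \<open>\<alpha> 1, \<dots>, \<alpha> d\<close>, repeated
  according to multiplicity.
\<close>
definition Psi :: "nat \<Rightarrow> nat \<Rightarrow> (nat \<Rightarrow> complex) \<Rightarrow> complex" where
  "Psi n d \<alpha> = (\<Prod>(j, k)\<in>{(j, k). 1 \<le> j \<and> j < k \<and> k \<le> d}. (cyclotomic_hom n (\<alpha> j) (\<alpha> k))\<^sup>2)"

lemma primitive_unity_roots_eq:
  assumes "n > 0"
  shows "primitive_unity_roots n =
    (\<lambda>k. exp (2 * of_real pi * \<i> * of_nat k / of_nat n)) ` totatives n"
proof -
  define e where "e = (\<lambda>k::nat. exp (2 * of_real pi * \<i> * of_nat k / of_nat n))"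
  have n1: "1 \<le> n" using assms by simp
  have pow: "e k ^ m = 1 \<longleftrightarrow> n dvd k * m" for k m
  proof -
    have "e k ^ m = exp (2 * of_real pi * \<i> * of_nat (k * m) / of_nat n)"
      unfolding e_def exp_of_nat_mult[symmetric] by (simp add: algebra_simps)
    then show ?thesis using complex_root_unity_eq_1[OF n1, of "k * m"] by simp
  qed
  have prim: "e k \<in> primitive_unity_roots n \<longleftrightarrow> coprime k n" for k
  proof
    assume "coprime k n"
    then have "n dvd k * m \<longleftrightarrow> n dvd m" for m
      by (simp add: coprime_commute coprime_dvd_mult_right_iff)
    then show "e k \<in> primitive_unity_roots n"
      using assms by (auto simp: primitive_unity_roots_def pow dest: dvd_imp_le)
  next
    assume p: "e k \<in> primitive_unity_roots n"
    show "coprime k n"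
    proof (rule ccontr)
      define g where "g = gcd k n"
      assume "\<not> coprime k n"
      then have "g \<noteq> 1" by (simp add: g_def coprime_iff_gcd_eq_1)
      moreover have "g > 0" using assms by (simp add: g_def)
      ultimately have g: "g > 1" by simp
      obtain a b where a: "k = g * a" and b: "n = g * b"
        unfolding g_def by (meson dvdE gcd_dvd1 gcd_dvd2)
      have "n dvd k * b" unfolding a b by simp
      then have "e k ^ b = 1" by (simp add: pow)
      moreover have "0 < b" "b < n" using g assms b by auto
      ultimately show False using p by (auto simp: primitive_unity_roots_def)
    qed
  qed
  show ?thesis unfolding e_def[symmetric]
  proof (intro equalityI subsetI)
    fix z assume z: "z \<in> primitive_unity_roots n"
    then have "z ^ n = 1" by (simp add: primitive_unity_roots_def)
    then obtain j where j: "j < n" "z = e j"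
      using complex_roots_unity[OF n1] by (auto simp: e_def)
    then have c: "coprime j n" using prim z by simp
    show "z \<in> e ` totatives n"
    proof (cases "j = 0")
      case True
      then have "n = 1" using c by simp
      moreover have "e 0 = e n" using assms by (simp add: e_def)
      ultimately show ?thesis using j True by (auto simp: totatives_def)
    qed (use j c in \<open>auto simp: totatives_def\<close>)
  qed (auto simp: prim totatives_def)
qed

lemma card_primitive_unity_roots:
  assumes "n > 0"
  shows "card (primitive_unity_roots n) = totient n"
proof -
  have "inj_on (\<lambda>k. exp (2 * of_real pi * \<i> * of_nat k / of_nat n)) (totatives n)"
  proof (rule inj_onI)
    fix x y
    assume xy: "x \<in> totatives n" "y \<in> totatives n" and
      eq: "exp (2 * of_real pi * \<i> * of_nat x / of_nat n) = exp (2 * of_real pi * \<i> * of_nat y / of_nat n)"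
    have "x mod n = y mod n"
      using eq complex_root_unity_eq[of n x y] assms by (simp add: Suc_le_eq cong_def)
    moreover have "0 < x" "x \<le> n" "0 < y" "y \<le> n" using xy by (auto simp: totatives_def)
    ultimately show "x = y"
      by (metis le_neq_implies_less mod_less mod_self not_gr_zero)
  qed
  then show ?thesis
    unfolding primitive_unity_roots_eq[OF assms] by (simp add: card_image totient_def)
qed

lemma cyclotomic_hom_eq:
  assumes "n > 0" "y \<noteq> 0"
  shows "cyclotomic_hom n x y = y ^ totient n * poly (cyclotomic n) (x / y)"
proof -
  have "y ^ totient n * poly (cyclotomic n) (x / y) =
      (\<Prod>\<zeta>\<in>primitive_unity_roots n. y * (x / y - \<zeta>))"
    unfolding cyclotomic_def card_primitive_unity_roots[OF assms(1), symmetric]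
    by (simp add: poly_prod prod.distrib)
  also have "\<dots> = cyclotomic_hom n x y"
    unfolding cyclotomic_hom_def using assms by (intro prod.cong) (auto simp: field_simps)
  finally show ?thesis by simp
qed

end

theory Submission
  imports Defs
begin

text \<open>
  \<open>\<Psi>\<^sub>n(P)\<close> is the square of \<open>q = (\<Prod>j<k. C(\<alpha>\<^sub>j, \<alpha>\<^sub>k))\<close>, where the homogenized cyclotomic polynomial \<open>C\<close> has
  integer coefficients and is symmetric, because inverting the primitive roots of unity changes it
  only by a constant factor, which is \<open>1\<close> as \<open>C(1, 1) \<noteq> 0\<close>. So every power of \<open>q\<close> is a symmetric
  integer polynomial in the roots. The sum of an integer polynomial over all permutations of the
  roots is an integer, since inclusion-exclusion reduces permuted monomials to power sums. Hence
  \<open>d! q\<^sup>k\<close> is an integer for every \<open>k\<close>, which bounds the denominators of the powers of the rational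
  number \<open>q\<close> and forces \<open>q\<close> to be an integer.
\<close>

section \<open>Polynomials with integer coefficients\<close>

lemma Ints_coeff_mult:
  fixes p q :: "'a :: comm_ring_1 poly"
  assumes "\<And>i. coeff p i \<in> \<int>" "\<And>i. coeff q i \<in> \<int>"
  shows "coeff (p * q) i \<in> \<int>"
  unfolding coeff_mult using assms by (intro Ints_sum Ints_mult) auto

lemma Ints_coeff_prod:
  fixes f :: "'b \<Rightarrow> 'a :: comm_ring_1 poly"
  assumes "\<And>x i. x \<in> A \<Longrightarrow> coeff (f x) i \<in> \<int>"
  shows "coeff (prod f A) i \<in> \<int>"
proof -
  have "\<forall>i. coeff (prod f A) i \<in> \<int>"
    using assms
  proof (induction A rule: infinite_finite_induct)
    case (insert x A)
    then show ?case by (auto intro!: Ints_coeff_mult)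
  qed (auto simp: coeff_1)
  then show ?thesis ..
qed

text \<open>Long division by a monic polynomial never divides a coefficient: the top coefficient of
  \<open>g * h\<close> is that of \<open>h\<close>, and removing the leading monomial of
  \<open>h\<close> lowers its degree while \<open>g * h\<close> stays integral.\<close>

lemma Ints_coeff_cofactor:
  fixes g h :: "'a :: idom poly"
  assumes g: "lead_coeff g = 1" "\<And>i. coeff g i \<in> \<int>"
    and "\<And>i. coeff (g * h) i \<in> \<int>"
  shows "coeff h i \<in> \<int>"
  using assms(3)
proof (induction "degree h" arbitrary: h i rule: less_induct)
  case less
  have lc: "lead_coeff h \<in> \<int>"
    using less.prems[of "degree g + degree h"] g(1) by (simp add: coeff_mult_degree_sum)
  define t where "t = monom (lead_coeff h) (degree h)"
  have t: "coeff t i \<in> \<int>" for i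
    using lc by (auto simp: t_def)
  show ?case
  proof (cases "h = t")
    case False
    have "degree (h - t) \<le> degree h"
      by (intro degree_diff_le) (auto simp: t_def degree_monom_le)
    moreover have "coeff (h - t) (degree h) = 0"
      by (simp add: t_def)
    ultimately have "degree (h - t) < degree h"
      using False by (metis eq_iff_diff_eq_0 leading_coeff_0_iff order_le_less)
    moreover have "coeff (g * (h - t)) i \<in> \<int>" for i
      using less.prems[of i] Ints_coeff_mult[OF g(2) t, of i] by (simp add: right_diff_distrib)
    ultimately have "coeff (h - t) i \<in> \<int>"
      by (rule less.hyps)
    then show ?thesis
      using t[of i] by (metis Ints_add coeff_diff diff_add_cancel)
  qed (use t in metis)
qed

section \<open>Cyclotomic polynomials and their homogeneous forms\<close>

lemma finite_primitive_unity_roots: "finite (primitive_unity_roots n)"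
proof (cases "n = 0")
  case False
  show ?thesis
    by (rule finite_subset[OF _ finite_roots_unity[of n]])
      (use False in \<open>auto simp: primitive_unity_roots_def\<close>)
qed (simp add: primitive_unity_roots_def)

lemma degree_cyclotomic: "degree (cyclotomic n) = card (primitive_unity_roots n)"
  unfolding cyclotomic_def by (subst degree_prod_sum_eq) auto

lemma lead_coeff_cyclotomic: "lead_coeff (cyclotomic n) = 1"
  unfolding cyclotomic_def by (subst lead_coeff_prod) simp

text \<open>An \<open>n\<close>-th root of unity is primitive for its multiplicative order
  \<open>m\<close>, and \<open>m\<close> divides \<open>n\<close> because \<open>n mod m\<close> is
  an exponent below the least one.\<close>

lemma Union_primitive_unity_roots:
  assumes "n > 0"
  shows "(\<Union>m\<in>{m. m dvd n}. primitive_unity_roots m) = {z. z ^ n = 1}"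
proof (intro equalityI subsetI)
  fix z :: complex assume "z \<in> {z. z ^ n = 1}"
  then have zn: "z ^ n = 1" by simp
  define m where "m = (LEAST m. 0 < m \<and> z ^ m = 1)"
  have m: "0 < m \<and> z ^ m = 1"
    unfolding m_def by (rule LeastI[of _ n]) (use assms zn in auto)
  have least: "z ^ k \<noteq> 1" if "0 < k" "k < m" for k
    using that not_less_Least unfolding m_def by blast
  have "z ^ n = (z ^ m) ^ (n div m) * z ^ (n mod m)"
    by (simp flip: power_mult power_add)
  then have "z ^ (n mod m) = 1"
    using m zn by simp
  then have "n mod m = 0"
    using least[of "n mod m"] m by auto
  then show "z \<in> (\<Union>m\<in>{m. m dvd n}. primitive_unity_roots m)"
    using m least by (auto simp: primitive_unity_roots_def)
qed (auto simp: primitive_unity_roots_def power_mult elim!: dvdE)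

text \<open>By the partition of the \<open>n\<close>-th roots of unity by order, both sides have
  degree at most \<open>n\<close>, coefficient \<open>1\<close> at \<open>n\<close>, and vanish at
  the same \<open>n\<close> points.\<close>

lemma prod_cyclotomic:
  assumes "n > 0"
  shows "(\<Prod>m | m dvd n. cyclotomic m) = monom 1 n - 1"
proof -
  have "(\<Prod>m | m dvd n. cyclotomic m) =
      (\<Prod>z\<in>(\<Union>m\<in>{m. m dvd n}. primitive_unity_roots m). [:-z, 1:])"
    unfolding cyclotomic_def
  proof (rule prod.UNION_disjoint[symmetric])
    show "\<forall>i\<in>{m. m dvd n}. \<forall>j\<in>{m. m dvd n}. i \<noteq> j \<longrightarrow>
        primitive_unity_roots i \<inter> primitive_unity_roots j = {}"
      by (auto simp: primitive_unity_roots_def) (metis linorder_neqE_nat)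
  qed (use assms finite_primitive_unity_roots in auto)
  also have "\<dots> = (\<Prod>z | z ^ n = 1. [:-z, 1:])"
    by (simp only: Union_primitive_unity_roots[OF assms])
  also have "\<dots> = monom 1 n - 1"
  proof (rule poly_eqI_degree_lead_coeff[where A = "{z. z ^ n = 1}"])
    have c: "card {z :: complex. z ^ n = 1} = n"
      using assms by (intro card_roots_unity_eq)
    have d: "degree (\<Prod>z | z ^ n = (1::complex). [:-z, 1:]) = n"
      by (subst degree_prod_sum_eq) (auto simp: c)
    show "degree (\<Prod>z | z ^ n = (1::complex). [:-z, 1:]) \<le> n" using d by simp
    show "degree (monom 1 n - 1 :: complex poly) \<le> n"
      by (intro degree_diff_le) (auto simp: degree_monom_le)
    have "coeff (\<Prod>z | z ^ n = (1::complex). [:-z, 1:]) n = 1"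
      using lead_coeff_prod[of "\<lambda>z. [:-z, 1:]" "{z. z ^ n = (1::complex)}"] d by simp
    then show "coeff (\<Prod>z | z ^ n = (1::complex). [:-z, 1:]) n = coeff (monom 1 n - 1) n"
      using assms by (simp add: coeff_1)
    show "card {z :: complex. z ^ n = 1} \<ge> n" using c by simp
    fix z :: complex assume z: "z \<in> {z. z ^ n = 1}"
    then show "poly (\<Prod>z | z ^ n = 1. [:-z, 1:]) z = poly (monom 1 n - 1) z"
      using finite_roots_unity[of n, where 'a = complex] assms
      by (auto simp: poly_prod poly_monom prod_zero_iff)
  qed
  finally show ?thesis .
qed

text \<open>Strong induction: \<open>cyclotomic n\<close> is the cofactor in
  \<open>monom 1 n - 1\<close> of the product over the proper divisors, which is monic and
  integral.\<close>

lemma Ints_coeff_cyclotomic: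
  assumes "n > 0"
  shows "coeff (cyclotomic n) i \<in> \<int>"
  using assms
proof (induction n arbitrary: i rule: less_induct)
  case (less n)
  define g where "g = (\<Prod>m\<in>{m. m dvd n} - {n}. cyclotomic m)"
  have "g * cyclotomic n = monom 1 n - 1"
    unfolding g_def prod_cyclotomic[OF less.prems, symmetric]
    using less.prems by (subst prod.remove[of "{m. m dvd n}" n]) (auto simp: mult.commute)
  then have "coeff (g * cyclotomic n) i \<in> \<int>" for i
    by (simp add: coeff_1)
  moreover have "lead_coeff g = 1"
    unfolding g_def by (subst lead_coeff_prod) (simp add: lead_coeff_cyclotomic)
  moreover have "coeff g i \<in> \<int>" for i
    unfolding g_def
  proof (rule Ints_coeff_prod)
    fix m i assume "m \<in> {m. m dvd n} - {n}"
    then have "0 < m" "m < n"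
      using less.prems by (auto intro: dvd_pos_nat dest: dvd_imp_le)
    then show "coeff (cyclotomic m) i \<in> \<int>"
      using less.IH by blast
  qed
  ultimately show ?case
    by (rule Ints_coeff_cofactor[rotated 2])
qed

text \<open>This form exhibits an integer polynomial in \<open>x\<close> and \<open>y\<close>. At
  \<open>y = 0\<close> only the top term survives, with coefficient \<open>1\<close>.\<close>

lemma cyclotomic_hom_eq_sum:
  assumes "n > 0"
  shows "cyclotomic_hom n x y =
    (\<Sum>i\<le>totient n. coeff (cyclotomic n) i * x ^ i * y ^ (totient n - i))"
proof (cases "y = 0")
  case True
  have "coeff (cyclotomic n) (totient n) = 1"
    using lead_coeff_cyclotomic[of n]
    by (simp add: degree_cyclotomic card_primitive_unity_roots[OF assms])
  moreover have "(\<Sum>i\<le>totient n. coeff (cyclotomic n) i * x ^ i * y ^ (totient n - i)) =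
      (\<Sum>i\<in>{totient n}. coeff (cyclotomic n) i * x ^ i * y ^ (totient n - i))"
    using True by (intro sum.mono_neutral_right) auto
  ultimately show ?thesis
    using True by (simp add: cyclotomic_hom_def card_primitive_unity_roots[OF assms])
next
  case False
  then show ?thesis
    unfolding cyclotomic_hom_eq[OF assms False] poly_altdef degree_cyclotomic
      card_primitive_unity_roots[OF assms] sum_distrib_left
    by (intro sum.cong) (auto simp: field_simps simp flip: power_add)
qed

lemma cyclotomic_hom_commute:
  assumes "n > 1"
  shows "cyclotomic_hom n x y = cyclotomic_hom n y x"
proof -
  let ?R = "primitive_unity_roots n"
  define K where "K = (\<Prod>\<zeta>\<in>?R. - inverse \<zeta>)"
  have nz: "\<zeta> \<noteq> 0" if "\<zeta> \<in> ?R" for \<zeta>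
    using that by (auto simp: primitive_unity_roots_def power_0_left split: if_splits)
  have inv: "inverse \<zeta> \<in> ?R" if "\<zeta> \<in> ?R" for \<zeta>
    using that by (auto simp: primitive_unity_roots_def power_inverse)
  have swap: "cyclotomic_hom n x y = K * cyclotomic_hom n y x" for x y
  proof -
    have "cyclotomic_hom n x y = (\<Prod>\<zeta>\<in>?R. x - inverse \<zeta> * y)"
      unfolding cyclotomic_hom_def
      by (rule prod.reindex_bij_witness[of _ inverse inverse]) (auto simp: inv)
    also have "\<dots> = (\<Prod>\<zeta>\<in>?R. - inverse \<zeta> * (y - \<zeta> * x))"
      using nz by (intro prod.cong) (auto simp: field_simps)
    finally show ?thesis
      by (simp only: K_def cyclotomic_hom_def prod.distrib)
  qed
  \<comment> \<open>Here \<open>n > 1\<close> is essential: for \<open>n = 1\<close> the form is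
    \<open>x - y\<close>, which changes sign under the swap.\<close>
  have "1 \<notin> ?R"
    using assms by (auto simp: primitive_unity_roots_def intro!: exI[of _ 1])
  then have "cyclotomic_hom n 1 1 \<noteq> 0"
    using finite_primitive_unity_roots by (auto simp: cyclotomic_hom_def)
  then have "K = 1"
    using swap[of 1 1] by simp
  then show ?thesis
    using swap by simp
qed

section \<open>Newton's identities for power sums\<close>

text \<open>
  With \<open>R = (\<Prod>i\<in>A. 1 - \<alpha> i * X)\<close> and \<open>p\<close> the generating series of the power sums,
  \<open>R * p = card A * R - X * R'\<close>, where \<open>R\<close> has constant coefficient \<open>1\<close>.
\<close>
lemma Ints_power_sum:
  fixes \<alpha> :: "'b \<Rightarrow> 'a :: {idom, semiring_char_0}"
  assumes "finite A" and int: "\<And>i. coeff (\<Prod>i\<in>A. [:- \<alpha> i, 1:]) i \<in> \<int>"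
  shows "(\<Sum>i\<in>A. \<alpha> i ^ k) \<in> \<int>"
proof -
  define R where "R = (\<Prod>i\<in>A. [:1, - \<alpha> i:])"
  define p where "p = Abs_fps (\<lambda>k. \<Sum>i\<in>A. \<alpha> i ^ k)"
  \<comment> \<open>Reversing the coefficients turns each factor \<open>X - \<alpha> i\<close> into
    \<open>1 - \<alpha> i * X\<close>.\<close>
  have "R = reflect_poly (\<Prod>i\<in>A. [:- \<alpha> i, 1:])"
    unfolding R_def reflect_poly_prod by (intro prod.cong) (auto simp: reflect_poly_def)
  then have R: "coeff R i \<in> \<int>" for i
    using int by (simp add: coeff_reflect_poly)
  have R0: "coeff R 0 = 1"
    unfolding R_def by (simp add: poly_prod flip: poly_0_coeff_0)
  \<comment> \<open>\<open>T\<close> is the numerator of \<open>p\<close>, the sum of the fractions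
    \<open>1 / (1 - \<alpha> i * X)\<close>, over the common denominator \<open>R\<close>.\<close>
  define T where "T = (\<Sum>i\<in>A. \<Prod>j\<in>A-{i}. [:1, - \<alpha> j:])"
  have "[:0, 1:] * pderiv R = (\<Sum>i\<in>A. R - (\<Prod>j\<in>A-{i}. [:1, - \<alpha> j:]))"
    unfolding R_def pderiv_prod sum_distrib_left
  proof (intro sum.cong refl)
    fix i assume "i \<in> A"
    define S where "S = (\<Prod>j\<in>A-{i}. [:1, - \<alpha> j:])"
    have "(\<Prod>j\<in>A. [:1, - \<alpha> j:]) = [:1, - \<alpha> i:] * S"
      using \<open>i \<in> A\<close> assms(1) by (simp add: prod.remove S_def)
    also have "\<dots> - S = [:0, 1:] * (S * pderiv [:1, - \<alpha> i:])"
      by (simp add: pderiv_pCons algebra_simps)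
    finally show "[:0, 1:] * ((\<Prod>j\<in>A-{i}. [:1, - \<alpha> j:]) * pderiv [:1, - \<alpha> i:]) =
        (\<Prod>j\<in>A. [:1, - \<alpha> j:]) - (\<Prod>j\<in>A-{i}. [:1, - \<alpha> j:])"
      by (simp add: S_def)
  qed
  then have "T = of_nat (card A) * R - [:0, 1:] * pderiv R"
    by (simp add: T_def sum_subtractf)
  then have T: "coeff T i \<in> \<int>" for i
    using R by (auto simp: of_nat_poly coeff_pderiv coeff_pCons split: nat.splits)
  have geom: "fps_of_poly [:1, - c:] * Abs_fps (\<lambda>k. c ^ k) = 1" for c :: 'a
    by (rule fps_ext) (auto simp: fps_of_poly_pCons ring_distribs gr0_conv_Suc mult.assoc)
  have "fps_of_poly R * Abs_fps (\<lambda>k. \<alpha> i ^ k) = fps_of_poly (\<Prod>j\<in>A-{i}. [:1, - \<alpha> j:])"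
    if "i \<in> A" for i
  proof -
    have "R = (\<Prod>j\<in>A-{i}. [:1, - \<alpha> j:]) * [:1, - \<alpha> i:]"
      using that assms(1) by (simp add: R_def prod.remove mult.commute)
    then show ?thesis
      by (simp only: fps_of_poly_mult mult.assoc geom mult_1_right)
  qed
  moreover have "p = (\<Sum>i\<in>A. Abs_fps (\<lambda>k. \<alpha> i ^ k))"
    by (rule fps_ext) (simp add: p_def fps_sum_nth)
  ultimately have RpT: "fps_of_poly R * p = fps_of_poly T"
    by (simp add: T_def sum_distrib_left fps_of_poly_sum)
  have "fps_nth p k \<in> \<int>"
  proof (induction k rule: less_induct)
    case (less k)
    \<comment> \<open>Comparing coefficients in \<open>R * p = T\<close> isolates the newest power
      sum, since \<open>R\<close> has constant coefficient \<open>1\<close>.\<close>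
    have "coeff T k = (\<Sum>i=0..k. coeff R i * fps_nth p (k - i))"
      by (simp flip: fps_of_poly_nth RpT add: fps_mult_nth)
    also have "\<dots> = fps_nth p k + (\<Sum>i=Suc 0..k. coeff R i * fps_nth p (k - i))"
      by (simp add: sum.atLeast_Suc_atMost R0)
    finally have "fps_nth p k = coeff T k - (\<Sum>i=Suc 0..k. coeff R i * fps_nth p (k - i))"
      by simp
    also have "\<dots> \<in> \<int>"
      using less R T by (intro Ints_diff Ints_sum Ints_mult) auto
    finally show ?case .
  qed
  then show ?thesis by (simp add: p_def)
qed

section \<open>Monomials summed over injective maps\<close>

text \<open>For finite \<open>I = A\<close> these are the permutations of \<open>A\<close>. A
  separate domain \<open>I\<close> allows induction on it, and extensionality makes each map
  determined by its values on \<open>I\<close>.\<close>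

definition inj_maps :: "'a set \<Rightarrow> 'b set \<Rightarrow> ('a \<Rightarrow> 'b) set" where
  "inj_maps I A = {g \<in> I \<rightarrow>\<^sub>E A. inj_on g I}"

lemma finite_inj_maps: "finite I \<Longrightarrow> finite A \<Longrightarrow> finite (inj_maps I A)"
  unfolding inj_maps_def by (rule finite_subset[of _ "I \<rightarrow>\<^sub>E A"]) (auto intro: finite_PiE)

lemma sum_inj_maps_insert:
  fixes f :: "('a \<Rightarrow> 'b) \<Rightarrow> 'c :: comm_monoid_add"
  assumes "finite I" "finite A" "j \<notin> I"
  shows "(\<Sum>g\<in>inj_maps (insert j I) A. f g) = (\<Sum>h\<in>inj_maps I A. \<Sum>a\<in>A - h ` I. f (h(j := a)))"
proof -
  have "(\<Sum>h\<in>inj_maps I A. \<Sum>a\<in>A - h ` I. f (h(j := a))) =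
      (\<Sum>(h, a)\<in>(SIGMA h:inj_maps I A. A - h ` I). f (h(j := a)))"
    using assms by (intro sum.Sigma finite_inj_maps) auto
  also have "\<dots> = (\<Sum>g\<in>inj_maps (insert j I) A. f g)"
  \<comment> \<open>An injection on \<open>insert j I\<close> is its restriction to \<open>I\<close>
    together with a value outside the image. Resetting \<open>j\<close> to \<open>undefined\<close>
    makes the restriction extensional again.\<close>
  proof (rule sum.reindex_bij_witness[of _ "\<lambda>g. (g(j := undefined), g j)" "\<lambda>(h, a). h(j := a)"])
    fix g assume g: "g \<in> inj_maps (insert j I) A"
    have img: "g(j := undefined) ` I = g ` I"
      using assms(3) by (intro image_cong) auto
    have "inj_on (g(j := undefined)) I \<longleftrightarrow> inj_on g I"
      using assms(3) by (intro inj_on_cong) auto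
    then show "(g(j := undefined), g j) \<in> (SIGMA h:inj_maps I A. A - h ` I)"
      using g assms(3) img by (auto simp: inj_maps_def PiE_def extensional_def)
  next
    fix x assume x: "x \<in> (SIGMA h:inj_maps I A. A - h ` I)"
    obtain h a where ha: "x = (h, a)" "h \<in> inj_maps I A" "a \<in> A" "a \<notin> h ` I"
      using x by auto
    have "inj_on (h(j := a)) I"
      using ha(2) assms(3) by (subst inj_on_cong[of _ _ h]) (auto simp: inj_maps_def)
    moreover have "h j = undefined"
      using ha(2) assms(3) by (auto simp: inj_maps_def PiE_def extensional_def)
    ultimately show "(case x of (h, a) \<Rightarrow> h(j := a)) \<in> inj_maps (insert j I) A"
      "((case x of (h, a) \<Rightarrow> h(j := a))(j := undefined), (case x of (h, a) \<Rightarrow> h(j := a)) j) = x"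
      using ha assms(3) by (auto simp: inj_maps_def PiE_def extensional_def inj_on_def)
  qed auto
  finally show ?thesis ..
qed

text \<open>Induction on \<open>I\<close>: let the value at the new index \<open>j\<close> range
  over all of \<open>A\<close>, which splits off a power sum, and subtract the collisions with each
  \<open>h i\<close>. A collision moves the exponent \<open>e j\<close> onto \<open>e i\<close>, so
  the induction hypothesis is needed for all exponents.\<close>

lemma Ints_sum_inj_maps_monomial:
  fixes \<alpha> :: "'b \<Rightarrow> 'a :: comm_ring_1" and I :: "'c set"
  assumes "finite A" and p: "\<And>k. (\<Sum>a\<in>A. \<alpha> a ^ k) \<in> \<int>" and "finite I"
  shows "(\<Sum>g\<in>inj_maps I A. \<Prod>i\<in>I. \<alpha> (g i) ^ e i) \<in> \<int>"
  using assms(3)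
proof (induction I arbitrary: e rule: finite_induct)
  case empty
  then show ?case by (simp add: inj_maps_def)
next
  case (insert j I)
  define M where "M = (\<lambda>e h. \<Prod>i\<in>I. \<alpha> (h i) ^ e i)"
  have "(\<Sum>g\<in>inj_maps (insert j I) A. \<Prod>i\<in>insert j I. \<alpha> (g i) ^ e i) =
      (\<Sum>h\<in>inj_maps I A. \<Sum>a\<in>A - h ` I. \<Prod>i\<in>insert j I. \<alpha> ((h(j := a)) i) ^ e i)"
    using insert assms(1) by (intro sum_inj_maps_insert) auto
  also have "\<dots> = (\<Sum>h\<in>inj_maps I A. (\<Sum>a\<in>A. \<alpha> a ^ e j) * M e h - (\<Sum>i\<in>I. M (e(i := e i + e j)) h))"
  proof (intro sum.cong refl)
    fix h assume h: "h \<in> inj_maps I A"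
    have "(\<Prod>i\<in>insert j I. \<alpha> ((h(j := a)) i) ^ e i) = \<alpha> a ^ e j * M e h" for a
    proof -
      have "(\<Prod>i\<in>I. \<alpha> ((h(j := a)) i) ^ e i) = M e h"
        unfolding M_def using insert by (intro prod.cong) auto
      then show ?thesis using insert by simp
    qed
    then have "(\<Sum>a\<in>A - h ` I. \<Prod>i\<in>insert j I. \<alpha> ((h(j := a)) i) ^ e i) =
        (\<Sum>a\<in>A - h ` I. \<alpha> a ^ e j) * M e h"
      by (simp add: sum_distrib_right)
    also have "(\<Sum>a\<in>A - h ` I. \<alpha> a ^ e j) = (\<Sum>a\<in>A. \<alpha> a ^ e j) - (\<Sum>a\<in>h ` I. \<alpha> a ^ e j)"
      using h assms(1) by (intro sum_diff) (auto simp: inj_maps_def)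
    also have "(\<Sum>a\<in>h ` I. \<alpha> a ^ e j) = (\<Sum>i\<in>I. \<alpha> (h i) ^ e j)"
      using h by (simp add: sum.reindex inj_maps_def)
    also have "((\<Sum>a\<in>A. \<alpha> a ^ e j) - (\<Sum>i\<in>I. \<alpha> (h i) ^ e j)) * M e h =
        (\<Sum>a\<in>A. \<alpha> a ^ e j) * M e h - (\<Sum>i\<in>I. \<alpha> (h i) ^ e j * M e h)"
      by (simp add: left_diff_distrib sum_distrib_right)
    also have "(\<Sum>i\<in>I. \<alpha> (h i) ^ e j * M e h) = (\<Sum>i\<in>I. M (e(i := e i + e j)) h)"
    proof (intro sum.cong refl)
      fix i assume "i \<in> I"
      then show "\<alpha> (h i) ^ e j * M e h = M (e(i := e i + e j)) h"
        unfolding M_def using insert(1)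
        by (simp add: prod.remove[of I i] power_add mult_ac)
    qed
    finally show "(\<Sum>a\<in>A - h ` I. \<Prod>i\<in>insert j I. \<alpha> ((h(j := a)) i) ^ e i) =
        (\<Sum>a\<in>A. \<alpha> a ^ e j) * M e h - (\<Sum>i\<in>I. M (e(i := e i + e j)) h)" .
  qed
  also have "\<dots> = (\<Sum>a\<in>A. \<alpha> a ^ e j) * (\<Sum>h\<in>inj_maps I A. M e h) -
      (\<Sum>i\<in>I. \<Sum>h\<in>inj_maps I A. M (e(i := e i + e j)) h)"
    by (subst sum.swap) (simp add: sum_subtractf sum_distrib_left)
  also have "\<dots> \<in> \<int>"
  proof (intro Ints_diff Ints_mult p)
    have int: "(\<Sum>h\<in>inj_maps I A. M e' h) \<in> \<int>" for e'
      unfolding M_def by (rule insert.IH)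
    show "(\<Sum>h\<in>inj_maps I A. M e h) \<in> \<int>" by (rule int)
    show "(\<Sum>i\<in>I. \<Sum>h\<in>inj_maps I A. M (e(i := e i + e j)) h) \<in> \<int>"
      by (rule Ints_sum) (rule int)
  qed
  finally show ?case .
qed

section \<open>Integer polynomials as multipliers\<close>

text \<open>
  The integer polynomials in the \<open>\<alpha> (g i)\<close>, as functions of \<open>g\<close>, form a ring that acts on the
  group of those \<open>f\<close> for which every \<open>\<Sum>g. f g * (\<Prod>i. \<alpha> (g i) ^ e i)\<close> is an integer.
\<close>
definition integral_sums :: "nat set \<Rightarrow> (nat \<Rightarrow> complex) \<Rightarrow> ((nat \<Rightarrow> nat) \<Rightarrow> complex) set" where
  "integral_sums A \<alpha> =
    {f. \<forall>e. (\<Sum>g\<in>inj_maps A A. f g * (\<Prod>i\<in>A. \<alpha> (g i) ^ e i)) \<in> \<int>}"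

definition multipliers :: "('b \<Rightarrow> 'a :: comm_ring_1) set \<Rightarrow> ('b \<Rightarrow> 'a) set" where
  "multipliers F = {u. \<forall>f\<in>F. (\<lambda>g. f g * u g) \<in> F}"

lemma multipliers_mult:
  "u \<in> multipliers F \<Longrightarrow> v \<in> multipliers F \<Longrightarrow> (\<lambda>g. u g * v g) \<in> multipliers F"
  unfolding multipliers_def mem_Collect_eq by (metis (no_types, lifting) ext mult.assoc)

lemma multipliers_1: "(\<lambda>_. 1) \<in> multipliers F"
  by (simp add: multipliers_def)

lemma multipliers_power: "u \<in> multipliers F \<Longrightarrow> (\<lambda>g. u g ^ k) \<in> multipliers F"
  by (induction k) (auto intro: multipliers_mult multipliers_1)

lemma multipliers_prod:
  "(\<And>x. x \<in> X \<Longrightarrow> u x \<in> multipliers F) \<Longrightarrow> (\<lambda>g. \<Prod>x\<in>X. u x g) \<in> multipliers F"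
  by (induction X rule: infinite_finite_induct) (auto intro: multipliers_mult multipliers_1)

lemma integral_sums_add:
  "f \<in> integral_sums A \<alpha> \<Longrightarrow> h \<in> integral_sums A \<alpha> \<Longrightarrow> (\<lambda>g. f g + h g) \<in> integral_sums A \<alpha>"
  by (simp add: integral_sums_def ring_distribs sum.distrib)

lemma multipliers_add:
  "u \<in> multipliers (integral_sums A \<alpha>) \<Longrightarrow> v \<in> multipliers (integral_sums A \<alpha>) \<Longrightarrow>
    (\<lambda>g. u g + v g) \<in> multipliers (integral_sums A \<alpha>)"
  unfolding multipliers_def mem_Collect_eq ring_distribs by (intro ballI integral_sums_add) simp_all

lemma multipliers_Ints:
  assumes "c \<in> \<int>"
  shows "(\<lambda>_. c) \<in> multipliers (integral_sums A \<alpha>)"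
proof -
  have "(\<Sum>g\<in>inj_maps A A. f g * c * (\<Prod>i\<in>A. \<alpha> (g i) ^ e i)) =
      c * (\<Sum>g\<in>inj_maps A A. f g * (\<Prod>i\<in>A. \<alpha> (g i) ^ e i))" for f e
    by (simp add: sum_distrib_left mult_ac)
  then show ?thesis
    using assms by (auto simp: multipliers_def integral_sums_def intro!: Ints_mult)
qed

lemma multipliers_sum:
  "(\<And>x. x \<in> X \<Longrightarrow> u x \<in> multipliers (integral_sums A \<alpha>)) \<Longrightarrow>
    (\<lambda>g. \<Sum>x\<in>X. u x g) \<in> multipliers (integral_sums A \<alpha>)"
  by (induction X rule: infinite_finite_induct) (auto intro: multipliers_add multipliers_Ints)

text \<open>The extra factor raises the exponent of \<open>j\<close> by one, which is absorbed
  because \<open>integral_sums\<close> quantifies over all exponents.\<close>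

lemma multipliers_var:
  assumes "finite A" "j \<in> A"
  shows "(\<lambda>g. \<alpha> (g j)) \<in> multipliers (integral_sums A \<alpha>)"
proof -
  have "\<alpha> (g j) * (\<Prod>i\<in>A. \<alpha> (g i) ^ e i) = (\<Prod>i\<in>A. \<alpha> (g i) ^ (e(j := Suc (e j))) i)" for g e
    using assms by (simp add: prod.remove[of A j] mult_ac)
  then show ?thesis
    by (auto simp: multipliers_def integral_sums_def mult.assoc)
qed

section \<open>Invariance under permutations and bounded denominators\<close>

text \<open>A permutation of \<open>A\<close> permutes its unordered pairs. These are encoded as
  increasing pairs, so \<open>s\<close> sorts the image pair, and symmetry of \<open>C\<close> hides
  the sorting. As an injective self-map of a finite set, \<open>s\<close> is onto.\<close>

lemma prod_pairs_inj_map: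
  fixes C :: "'a :: linorder \<Rightarrow> 'a \<Rightarrow> 'b :: comm_monoid_mult"
  assumes "finite A" and g: "g \<in> inj_maps A A" and sym: "\<And>x y. C x y = C y x"
  shows "(\<Prod>(j, k)\<in>{(j, k). j \<in> A \<and> k \<in> A \<and> j < k}. C (g j) (g k)) =
    (\<Prod>(j, k)\<in>{(j, k). j \<in> A \<and> k \<in> A \<and> j < k}. C j k)"
proof -
  let ?P = "{(j, k). j \<in> A \<and> k \<in> A \<and> j < k}"
  define s where "s = (\<lambda>(j, k). (min (g j) (g k), max (g j) (g k)))"
  have inj: "g x = g y \<longleftrightarrow> x = y" if "x \<in> A" "y \<in> A" for x y
    using g that by (auto simp: inj_maps_def inj_on_def)
  have gA: "g x \<in> A" if "x \<in> A" for x
    using g that by (auto simp: inj_maps_def)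
  have "finite ?P"
    by (rule finite_subset[of _ "A \<times> A"]) (use assms(1) in auto)
  moreover have "s ` ?P \<subseteq> ?P"
    using gA inj by (fastforce simp: s_def min_def max_def order_le_less)
  moreover have inj_s: "inj_on s ?P"
    by (rule inj_onI) (auto simp: s_def min_def max_def inj split: if_splits)
  ultimately have "s ` ?P = ?P"
    by (rule endo_inj_surj)
  then have "(\<Prod>(j, k)\<in>?P. C j k) = (\<Prod>x\<in>?P. (case s x of (j, k) \<Rightarrow> C j k))"
    using prod.reindex[OF inj_s, of "\<lambda>(j, k). C j k"] by simp
  also have "\<dots> = (\<Prod>(j, k)\<in>?P. C (g j) (g k))"
    by (intro prod.cong) (auto simp: s_def min_def max_def sym)
  finally show ?thesis ..
qed

text \<open>In lowest terms \<open>q = a / b\<close>, the power \<open>b ^ k\<close> divides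
  \<open>N\<close> for every \<open>k\<close>, which leaves only \<open>b = 1\<close>.\<close>

lemma Ints_if_powers_bounded_denominator:
  fixes q :: "'a :: field_char_0"
  assumes "N > 0" and int: "\<And>k. of_nat N * q ^ k \<in> \<int>"
  shows "q \<in> \<int>"
proof -
  have "of_nat N * q \<in> \<int>" using int[of 1] by simp
  then have "of_nat N * q / of_nat N \<in> \<rat>"
    using Ints_subset_Rats by (intro Rats_divide) auto
  then have "q \<in> \<rat>"
    using assms(1) by simp
  then obtain a b where ab: "b > 0" "coprime a b" "q = of_int a / of_int b"
    by (rule Rats_cases')
  have dvd: "b ^ k dvd int N" for k
  proof -
    obtain z where "of_nat N * q ^ k = of_int z"
      using int[of k] by (auto elim: Ints_cases)
    then have "(of_int (int N * a ^ k) :: 'a) = of_int (z * b ^ k)"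
      using ab(1) by (simp add: ab(3) field_simps)
    then have "int N * a ^ k = z * b ^ k"
      by (simp only: of_int_eq_iff)
    then have "b ^ k dvd int N * a ^ k" by simp
    then show ?thesis
      using ab(2) by (simp add: coprime_dvd_mult_left_iff coprime_commute)
  qed
  \<comment> \<open>The exponent \<open>k = N\<close> suffices, since \<open>2 ^ N\<close> exceeds
    \<open>N\<close>.\<close>
  have "\<not> b \<ge> 2"
  proof
    assume "b \<ge> 2"
    then have "(2::int) ^ N \<le> b ^ N" by (intro power_mono) auto
    also have "\<dots> \<le> int N" using dvd[of N] assms(1) by (intro zdvd_imp_le) auto
    finally show False
      using less_exp[of N] by (metis of_nat_less_iff not_less of_nat_numeral of_nat_power)
  qed
  then have "b = 1" using ab(1) by simp
  then show ?thesis using ab(3) by simp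
qed

theorem theorem8p2:
  fixes P :: "int poly" and d n :: nat and \<alpha> :: "nat \<Rightarrow> complex"
  assumes "lead_coeff P = 1"
    and "degree P = d"
    and "map_poly of_int P = (\<Prod>i = 1..d. [:- \<alpha> i, 1:])"
    and "n > 1"
  shows "\<exists>m :: int. Psi n d \<alpha> = (of_int m)\<^sup>2"
proof -
  let ?A = "{1..d}" and ?C = "cyclotomic_hom n"
  let ?B = "multipliers (integral_sums ?A \<alpha>)"
  define pairs where "pairs = {(j, k). j \<in> ?A \<and> k \<in> ?A \<and> j < k}"
  define Q where "Q = (\<lambda>g. \<Prod>(j, k)\<in>pairs. ?C (\<alpha> (g j)) (\<alpha> (g k)))"
  define q where "q = (\<Prod>(j, k)\<in>pairs. ?C (\<alpha> j) (\<alpha> k))"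
  have n: "n > 0" using assms(4) by simp
  have p: "(\<Sum>i\<in>?A. \<alpha> i ^ k) \<in> \<int>" for k
    by (rule Ints_power_sum) (simp_all only: assms(3)[symmetric] coeff_map_poly of_int_0 Ints_of_int
        finite_atLeastAtMost)
  \<comment> \<open>The constant \<open>1\<close> is the element on which the multipliers act; its
    membership is the integrality of the permuted monomial sums.\<close>
  have one: "(\<lambda>_. 1) \<in> integral_sums ?A \<alpha>"
    using Ints_sum_inj_maps_monomial[of ?A \<alpha> ?A, OF _ p] by (simp add: integral_sums_def)
  have "(\<lambda>g. ?C (\<alpha> (g j)) (\<alpha> (g k))) \<in> ?B" if "j \<in> ?A" "k \<in> ?A" for j k
    unfolding cyclotomic_hom_eq_sum[OF n]
    by (intro multipliers_sum multipliers_mult multipliers_power multipliers_Ints multipliers_var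
        Ints_coeff_cyclotomic n that finite_atLeastAtMost)
  then have Q: "Q \<in> ?B"
    unfolding Q_def case_prod_unfold by (intro multipliers_prod) (auto simp: pairs_def)
  have Qq: "Q g = q" if "g \<in> inj_maps ?A ?A" for g
    unfolding Q_def q_def pairs_def
    by (rule prod_pairs_inj_map[OF _ that, where C = "\<lambda>j k. ?C (\<alpha> j) (\<alpha> k)"])
      (auto intro: cyclotomic_hom_commute[OF assms(4)])
  \<comment> \<open>\<open>N\<close> counts the permutations of \<open>{1..d}\<close>, so it is
    \<open>d!\<close>; the identity shows that it is positive.\<close>
  define N where "N = card (inj_maps ?A ?A)"
  have "restrict id ?A \<in> inj_maps ?A ?A"
    by (auto simp: inj_maps_def inj_on_def)
  then have "N > 0"
    unfolding N_def card_gt_0_iff by (auto intro: finite_inj_maps)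
  moreover have "of_nat N * q ^ k \<in> \<int>" for k
  proof -
    have "(\<lambda>g. Q g ^ k) \<in> integral_sums ?A \<alpha>"
      using multipliers_power[OF Q, of k] one by (fastforce simp: multipliers_def)
    \<comment> \<open>With all exponents zero the monomial is \<open>1\<close>, and as
      \<open>Q\<close> is constantly \<open>q\<close> on permutations, the sum collapses to
      \<open>N * q ^ k\<close>.\<close>
    then have "(\<Sum>g\<in>inj_maps ?A ?A. Q g ^ k * (\<Prod>i\<in>?A. \<alpha> (g i) ^ 0)) \<in> \<int>"
      unfolding integral_sums_def by (auto dest: spec[of _ "\<lambda>_. 0"])
    then show ?thesis
      by (simp add: Qq N_def)
  qed
  ultimately have "q \<in> \<int>"
    by (rule Ints_if_powers_bounded_denominator)
  then obtain m where "q = of_int m"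
    by (auto elim: Ints_cases)
  moreover have "Psi n d \<alpha> = q\<^sup>2"
  proof -
    have "{(j, k). 1 \<le> j \<and> j < k \<and> k \<le> d} = pairs"
      by (auto simp: pairs_def)
    then show ?thesis
      by (simp add: Psi_def q_def case_prod_unfold flip: prod_power_distrib)
  qed
  ultimately show ?thesis by blast
qed

end
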